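(* Let $c$ be the (real or complex) space of convergent sequences equipped with the norm $\|x\|_\infty=\sup_{k\in\mathbb{N}}|x_k|$. For every sequence $(x^{(n)})_{n\in\mathbb{N}}$ of elements $x^{(n)}=(x_k^{(n)})_{k\in\mathbb{N}}\in c$ and every $x=(x_k)_{k\in\mathbb{N}}\in c$, one has $x^{(n)}\to x$ in $c$ as $n\to\infty$ if and only if both of the following conditions hold: (1) $\lim_{m\to\infty}x_m^{(n)}\to\lim_{m\to\infty}x_m$ as $n\to\infty$, and for every $k\in\mathbb{N}$, $x_k^{(n)}\to x_k$ as $n\to\infty$; (2) for every $\varepsilon>0$ there exists $K\in\mathbb{Z}_+$ such that for all $n\in\mathbb{N}$, $\sup_{k\ge K+1}\left|x_k^{(n)}-\lim_{m\to\infty}x_m^{(n)}\right|<\varepsilon$.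
   Context: $\mathbb{N}=\{1,2,\dots\}$ and $\mathbb{Z}_+=\{0,1,2,\dots\}$. The space $c$ consists of all sequences $(x_k)_{k\in\mathbb{N}}$ of scalars (all real, or all complex) that converge to a finite limit. *)

theory Defs
  imports Complex_Main
begin

text \<open>
  The space \<open>c\<close> of convergent scalar sequences \<open>(x\<^sub>k)\<close>, \<open>k = 1, 2, \<dots>\<close>.  A sequence is a function
  on \<^typ>\<open>nat\<close> read at the arguments \<open>k \<ge> 1\<close>; its value at the argument \<open>0\<close>, which is not an index,
  is pinned to \<open>0\<close>, so that elements of the type and sequences indexed by \<open>1, 2, \<dots>\<close> correspond
  one to one.  The scalars are meant to be \<^typ>\<open>real\<close> or \<^typ>\<open>complex\<close>.
\<close>

typedef (overloaded) ('a::real_normed_field) conv_seq =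
    "{x :: nat \<Rightarrow> 'a. x 0 = 0 \<and> convergent x}"
  morphisms coord Abs_conv_seq
  by (rule exI[of _ "\<lambda>_. 0"]) (simp add: convergent_const)

setup_lifting type_definition_conv_seq

lemma coord_0 [simp]: "coord x 0 = 0"
  using coord[of x] by simp

lemma convergent_coord: "convergent (coord x)"
  using coord[of x] by simp

lemma conv_seq_eqI: "(\<And>k. k \<ge> 1 \<Longrightarrow> coord x k = coord y k) \<Longrightarrow> x = y"
  by (metis coord_0 coord_inject ext less_one linorder_not_less)

instantiation conv_seq :: (real_normed_field) real_vector
begin

lift_definition zero_conv_seq :: "'a conv_seq" is "\<lambda>_. 0"
  by (simp add: convergent_const)

lift_definition plus_conv_seq :: "'a conv_seq \<Rightarrow> 'a conv_seq \<Rightarrow> 'a conv_seq"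
  is "\<lambda>x y k. x k + y k"
  by (simp add: convergent_add)

lift_definition uminus_conv_seq :: "'a conv_seq \<Rightarrow> 'a conv_seq"
  is "\<lambda>x k. - x k"
  by (simp flip: convergent_minus_iff)

lift_definition minus_conv_seq :: "'a conv_seq \<Rightarrow> 'a conv_seq \<Rightarrow> 'a conv_seq"
  is "\<lambda>x y k. x k - y k"
  by (simp add: convergent_diff)

lift_definition scaleR_conv_seq :: "real \<Rightarrow> 'a conv_seq \<Rightarrow> 'a conv_seq"
  is "\<lambda>r x k. r *\<^sub>R x k"
  by (auto simp: convergent_def intro: tendsto_scaleR[OF tendsto_const])

instance
  by standard (transfer; simp add: fun_eq_iff algebra_simps)+

end

lemma bdd_above_norm_coord: "bdd_above ((\<lambda>k. norm (coord x k)) ` A)"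
proof -
  have "Bseq (coord x)"
    using convergent_coord by (rule convergent_imp_Bseq)
  then show ?thesis
    by (auto simp: Bseq_def bdd_above_def)
qed

instantiation conv_seq :: (real_normed_field) real_normed_vector
begin

definition norm_conv_seq :: "'a conv_seq \<Rightarrow> real"
  where "norm_conv_seq x = (SUP k\<in>{1..}. norm (coord x k))"

definition dist_conv_seq :: "'a conv_seq \<Rightarrow> 'a conv_seq \<Rightarrow> real"
  where "dist_conv_seq x y = norm (x - y)"

definition sgn_conv_seq :: "'a conv_seq \<Rightarrow> 'a conv_seq"
  where "sgn_conv_seq x = inverse (norm x) *\<^sub>R x"

definition uniformity_conv_seq :: "('a conv_seq \<times> 'a conv_seq) filter"
  where "uniformity_conv_seq = (INF e\<in>{0 <..}. principal {(x, y). dist x y < e})"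

definition open_conv_seq :: "'a conv_seq set \<Rightarrow> bool"
  where "open_conv_seq U \<longleftrightarrow> (\<forall>x\<in>U. \<forall>\<^sub>F (x', y) in uniformity. x' = x \<longrightarrow> y \<in> U)"

instance
proof
  have upper: "norm (coord x k) \<le> norm x" if "k \<ge> 1" for x :: "'a conv_seq" and k
    unfolding norm_conv_seq_def using that by (intro cSUP_upper bdd_above_norm_coord) auto
  have least: "norm x \<le> b" if "\<And>k. k \<ge> 1 \<Longrightarrow> norm (coord x k) \<le> b" for x :: "'a conv_seq" and b
    unfolding norm_conv_seq_def using that by (intro cSUP_least) auto
  fix x y :: "'a conv_seq" and a :: real
  show "dist x y = norm (x - y)"
    by (rule dist_conv_seq_def)
  show "sgn x = x /\<^sub>R norm x"
    by (rule sgn_conv_seq_def)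
  show "(uniformity :: ('a conv_seq \<times> 'a conv_seq) filter)
      = (INF e\<in>{0 <..}. principal {(x, y). dist x y < e})"
    by (rule uniformity_conv_seq_def)
  show "open U \<longleftrightarrow> (\<forall>x\<in>U. \<forall>\<^sub>F (x', y) in uniformity. x' = x \<longrightarrow> y \<in> U)"
    for U :: "'a conv_seq set"
    by (rule open_conv_seq_def)
  show "norm x = 0 \<longleftrightarrow> x = 0"
  proof
    assume "norm x = 0"
    then have "coord x k = 0" if "k \<ge> 1" for k
      using upper[OF that, of x] by simp
    then show "x = 0"
      by (intro conv_seq_eqI) (simp add: zero_conv_seq.rep_eq)
  next
    assume "x = 0"
    then show "norm x = 0"
      by (simp add: norm_conv_seq_def zero_conv_seq.rep_eq)
  qed
  show "norm (x + y) \<le> norm x + norm y"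
    by (rule least) (simp add: plus_conv_seq.rep_eq norm_triangle_le add_mono upper)
  have le: "norm (a *\<^sub>R x) \<le> \<bar>a\<bar> * norm x" for a and x :: "'a conv_seq"
    by (rule least) (simp add: scaleR_conv_seq.rep_eq mult_left_mono upper)
  show "norm (a *\<^sub>R x) = \<bar>a\<bar> * norm x"
  proof (cases "a = 0")
    case True
    then show ?thesis
      by (simp add: norm_conv_seq_def zero_conv_seq.rep_eq)
  next
    case False
    have "\<bar>a\<bar> * norm x \<le> norm (a *\<^sub>R x)"
      using le[of "inverse a" "a *\<^sub>R x"] False by (simp add: field_simps)
    with le[of a x] show ?thesis
      by simp
  qed
qed

end

end

theory Submission
  imports Defs
begin

text \<open>
  Both directions are \<open>\<epsilon>/3\<close>-arguments resting on the fact that the limit functional is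
  \<open>1\<close>-Lipschitz.  For necessity, all \<open>x\<^sup>(\<^sup>n\<^sup>)\<close> close to \<open>x\<close> share the tail index of \<open>x\<close>, and
  only finitely many terms remain; for sufficiency, the tails of \<open>x\<^sup>(\<^sup>n\<^sup>)\<close> and \<open>x\<close> are compared
  through their limits, which leaves finitely many coordinates.
\<close>

text \<open>The index 0 lies outside the supremum, but the coordinate there is pinned to 0, so the
  bound covers every \<open>k\<close>.\<close>

lemma norm_coord_le: "norm (coord x k) \<le> norm x"
proof (cases "k = 0")
  case False
  then show ?thesis
    unfolding norm_conv_seq_def by (intro cSUP_upper bdd_above_norm_coord) auto
qed simp

lemma norm_conv_seq_le: "(\<And>k. k \<ge> 1 \<Longrightarrow> norm (coord x k) \<le> b) \<Longrightarrow> norm x \<le> b"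
  unfolding norm_conv_seq_def by (intro cSUP_least) auto

lemma coord_tendsto_lim: "coord x \<longlonglongrightarrow> lim (coord x)"
  using convergent_coord convergent_LIMSEQ_iff by blast

text \<open>Every coordinate of \<open>x - y\<close> obeys this bound, and a non-strict bound
  survives passing to the limit in \<open>k\<close>.\<close>

lemma norm_lim_coord_diff_le: "norm (lim (coord x) - lim (coord y)) \<le> norm (x - y)"
proof (rule LIMSEQ_le_const2)
  show "(\<lambda>k. norm (coord x k - coord y k)) \<longlonglongrightarrow> norm (lim (coord x) - lim (coord y))"
    by (intro tendsto_intros coord_tendsto_lim)
  show "\<exists>N. \<forall>k\<ge>N. norm (coord x k - coord y k) \<le> norm (x - y)"
    using norm_coord_le[of "x - y"] by (simp add: minus_conv_seq.rep_eq)
qed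

lemma tendsto_coord:
  assumes "(X \<longlongrightarrow> x) F"
  shows "((\<lambda>n. coord (X n) k) \<longlongrightarrow> coord x k) F"
proof (rule metric_tendsto_imp_tendsto[OF assms])
  show "\<forall>\<^sub>F n in F. dist (coord (X n) k) (coord x k) \<le> dist (X n) x"
    using norm_coord_le[of "X _ - x" k]
    by (intro always_eventually) (simp add: dist_norm minus_conv_seq.rep_eq)
qed

lemma tendsto_lim_coord:
  assumes "(X \<longlongrightarrow> x) F"
  shows "((\<lambda>n. lim (coord (X n))) \<longlongrightarrow> lim (coord x)) F"
  by (rule metric_tendsto_imp_tendsto[OF assms])
     (simp add: dist_norm norm_lim_coord_diff_le)

lemma coord_near_lim:
  assumes "\<epsilon> > 0"
  shows "\<forall>\<^sub>F k in sequentially. norm (coord x k - lim (coord x)) < \<epsilon>"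
  using tendstoD[OF coord_tendsto_lim assms] by (simp add: dist_norm)

text \<open>A real \<open>SUP\<close> dominates its terms only when the set is bounded above; this
  is what lets a bound on the tail supremum be used at a single coordinate.\<close>

lemma bdd_above_norm_coord_diff: "bdd_above ((\<lambda>k. norm (coord x k - c)) ` A)"
proof -
  have "norm (coord x k - c) \<le> norm x + norm c" for k
    using norm_triangle_ineq4[of "coord x k" c] norm_coord_le[of x k] by linarith
  then show ?thesis
    by (intro bdd_aboveI2)
qed

lemma uniform_tail_if_tendsto:
  assumes X: "X \<longlonglongrightarrow> x" and "\<epsilon> > 0"
  shows "\<exists>K::nat. \<forall>n. (SUP k\<in>{K + 1..}. norm (coord (X n) k - lim (coord (X n)))) < \<epsilon>"
proof -
  \<comment> \<open>Three terms below \<open>e\<close> add up to less than half of \<epsilon>; the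
    slack keeps the inequality strict although a supremum yields only \<le>.\<close>
  define e where "e = \<epsilon> / 6"
  have e: "e > 0" using \<open>\<epsilon> > 0\<close> by (simp add: e_def)
  obtain N where N: "norm (X n - x) < e" if "n \<ge> N" for n
    using LIMSEQ_D[OF X e] by blast
  \<comment> \<open>Each of the finitely many \<open>X n\<close> with \<open>n < N\<close> has its
    own tail index, so one \<open>K\<close> serves them together with \<open>x\<close>.\<close>
  have "\<forall>\<^sub>F k in sequentially. norm (coord x k - lim (coord x)) < e \<and>
          (\<forall>n\<in>{..<N}. norm (coord (X n) k - lim (coord (X n))) < e)"
    by (intro eventually_conj eventually_ball_finite ballI coord_near_lim e) auto
  then obtain K where x: "norm (coord x k - lim (coord x)) < e"
    and small: "n < N \<Longrightarrow> norm (coord (X n) k - lim (coord (X n))) < e" if "k \<ge> K" for k n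
    unfolding eventually_sequentially by blast
  have "norm (coord (X n) k - lim (coord (X n))) \<le> 3 * e" if k: "k \<ge> K" for k n
  proof (cases "n < N")
    case True
    with small[OF k] e show ?thesis by fastforce
  next
    case False
    then have n: "norm (X n - x) < e" using N by simp
    have "norm (coord (X n) k - coord x k) \<le> norm (X n - x)"
      using norm_coord_le[of "X n - x" k] by (simp add: minus_conv_seq.rep_eq)
    moreover have "norm (lim (coord x) - lim (coord (X n))) \<le> norm (X n - x)"
      using norm_lim_coord_diff_le[of x "X n"] by (simp add: norm_minus_commute)
    \<comment> \<open>The detour through \<open>x\<close> and its limit: the outer terms are
      controlled by \<open>norm (X n - x)\<close>, the middle one by the tail of \<open>x\<close>
      alone.\<close>
    moreover have "coord (X n) k - lim (coord (X n)) =
        (coord (X n) k - coord x k) + (coord x k - lim (coord x))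
          + (lim (coord x) - lim (coord (X n)))"
      by simp
    ultimately show ?thesis
      using n x[OF k] by (smt (verit) norm_triangle_ineq)
  qed
  then have "(SUP k\<in>{K + 1..}. norm (coord (X n) k - lim (coord (X n)))) \<le> 3 * e" for n
    by (intro cSUP_least) auto
  moreover have "3 * e < \<epsilon>" using \<open>\<epsilon> > 0\<close> by (simp add: e_def)
  ultimately show ?thesis by (meson le_less_trans)
qed

lemma tendsto_if_uniform_tail:
  assumes lim: "(\<lambda>n. lim (coord (X n))) \<longlonglongrightarrow> lim (coord x)"
    and coord: "\<And>k. k \<ge> 1 \<Longrightarrow> (\<lambda>n. coord (X n) k) \<longlonglongrightarrow> coord x k"
    and tail: "\<And>\<epsilon>. \<epsilon> > 0 \<Longrightarrow> \<exists>K::nat. \<forall>n\<ge>1.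
      (SUP k\<in>{K + 1..}. norm (coord (X n) k - lim (coord (X n)))) < \<epsilon>"
  shows "X \<longlonglongrightarrow> x"
proof (rule tendstoI)
  fix \<epsilon> :: real assume "\<epsilon> > 0"
  define e where "e = \<epsilon> / 4"
  have e: "e > 0" using \<open>\<epsilon> > 0\<close> by (simp add: e_def)
  obtain K where K: "(SUP k\<in>{K + 1..}. norm (coord (X n) k - lim (coord (X n)))) < e"
    if "n \<ge> 1" for n
    using tail[OF e] by blast
  obtain L where L: "norm (coord x k - lim (coord x)) < e" if "k \<ge> L" for k
    using coord_near_lim[OF e] unfolding eventually_sequentially by blast
  \<comment> \<open>Coordinates up to \<open>K + L\<close> form a finite set, so their pointwise
    limits hold uniformly there. The clause \<open>n \<ge> 1\<close> gives access to the bound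
    \<open>K\<close>.\<close>
  have "\<forall>\<^sub>F n in sequentially. n \<ge> 1 \<and> dist (lim (coord (X n))) (lim (coord x)) < e \<and>
          (\<forall>k\<in>{1..K + L}. dist (coord (X n) k) (coord x k) < e)"
    by (intro eventually_conj eventually_ge_at_top eventually_ball_finite ballI
        tendstoD[OF lim e] tendstoD[OF coord e]) auto
  then show "\<forall>\<^sub>F n in sequentially. dist (X n) x < \<epsilon>"
  proof eventually_elim
    case (elim n)
    have "norm (coord (X n - x) k) \<le> 3 * e" if "k \<ge> 1" for k
    proof (cases "k \<le> K + L")
      case True
      with elim that e show ?thesis
        by (force simp: dist_norm minus_conv_seq.rep_eq)
    next
      \<comment> \<open>Now \<open>k\<close> exceeds both \<open>K\<close> and \<open>L\<close>, so
        the tails of \<open>X n\<close> and of \<open>x\<close> are both within \<open>e\<close> of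
        their limits.\<close>
      case False
      have "norm (coord (X n) k - lim (coord (X n)))
          \<le> (SUP k\<in>{K + 1..}. norm (coord (X n) k - lim (coord (X n))))"
        using False by (intro cSUP_upper bdd_above_norm_coord_diff) auto
      also have "\<dots> < e" using K elim by blast
      finally have "norm (coord (X n) k - lim (coord (X n))) < e" .
      moreover have "norm (lim (coord (X n)) - lim (coord x)) < e"
        using elim by (simp add: dist_norm)
      moreover have "norm (lim (coord x) - coord x k) < e"
        using L[of k] False by (simp add: norm_minus_commute)
      moreover have "coord (X n - x) k = (coord (X n) k - lim (coord (X n)))
          + (lim (coord (X n)) - lim (coord x)) + (lim (coord x) - coord x k)"
        by (simp add: minus_conv_seq.rep_eq)
      ultimately show ?thesis
        by (smt (verit) norm_triangle_ineq)
    qed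
    then have "norm (X n - x) \<le> 3 * e" by (rule norm_conv_seq_le)
    then show ?case using \<open>\<epsilon> > 0\<close> by (simp add: dist_norm e_def)
  qed
qed

text \<open>Working over an arbitrary \<open>real_normed_field\<close> yields the real and the
  complex case as instances of one equivalence.\<close>

lemma tendsto_conv_seq_iff:
  fixes X :: "nat \<Rightarrow> 'a::real_normed_field conv_seq"
  shows "X \<longlonglongrightarrow> x \<longleftrightarrow>
    ((\<lambda>n. lim (coord (X n))) \<longlonglongrightarrow> lim (coord x) \<and>
     (\<forall>k\<ge>1. (\<lambda>n. coord (X n) k) \<longlonglongrightarrow> coord x k)) \<and>
    (\<forall>\<epsilon>>0. \<exists>K::nat. \<forall>n\<ge>1.
       (SUP k\<in>{K + 1..}. norm (coord (X n) k - lim (coord (X n)))) < \<epsilon>)"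
proof (intro iffI conjI allI impI)
  assume X: "X \<longlonglongrightarrow> x"
  show "(\<lambda>n. lim (coord (X n))) \<longlonglongrightarrow> lim (coord x)" by (rule tendsto_lim_coord[OF X])
  show "(\<lambda>n. coord (X n) k) \<longlonglongrightarrow> coord x k" for k by (rule tendsto_coord[OF X])
  show "\<exists>K::nat. \<forall>n\<ge>1. (SUP k\<in>{K + 1..}. norm (coord (X n) k - lim (coord (X n)))) < \<epsilon>"
    if "\<epsilon> > 0" for \<epsilon>
    using uniform_tail_if_tendsto[OF X that] by blast
qed (rule tendsto_if_uniform_tail; blast)

theorem corollary5p1:
  shows "(\<forall>(X :: nat \<Rightarrow> real conv_seq) (x :: real conv_seq).
            X \<longlonglongrightarrow> x \<longleftrightarrow>
              ((\<lambda>n. lim (coord (X n))) \<longlonglongrightarrow> lim (coord x) \<and>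
               (\<forall>k\<ge>1. (\<lambda>n. coord (X n) k) \<longlonglongrightarrow> coord x k)) \<and>
              (\<forall>\<epsilon>>0. \<exists>K::nat. \<forall>n\<ge>1.
                 (SUP k\<in>{K + 1..}. \<bar>coord (X n) k - lim (coord (X n))\<bar>) < \<epsilon>)) \<and>
         (\<forall>(X :: nat \<Rightarrow> complex conv_seq) (x :: complex conv_seq).
            X \<longlonglongrightarrow> x \<longleftrightarrow>
              ((\<lambda>n. lim (coord (X n))) \<longlonglongrightarrow> lim (coord x) \<and>
               (\<forall>k\<ge>1. (\<lambda>n. coord (X n) k) \<longlonglongrightarrow> coord x k)) \<and>
              (\<forall>\<epsilon>>0. \<exists>K::nat. \<forall>n\<ge>1.
                 (SUP k\<in>{K + 1..}. cmod (coord (X n) k - lim (coord (X n)))) < \<epsilon>))"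
  \<comment> \<open>\<open>real_norm_def\<close> turns the norm of the real instance into the
    absolute value; \<open>cmod\<close> already abbreviates the complex norm.\<close>
  using tendsto_conv_seq_iff[where 'a = real] tendsto_conv_seq_iff[where 'a = complex]
  unfolding real_norm_def by blast

end
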